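(* A non-trivial MV-chain $A$ is profinite if and only if $A$ is isomorphic to $\mathrm{L}_n$ for some integer $n\geq 2$.
   Context: An MV-algebra is an Abelian monoid $(A,\oplus,0)$ with an involution $\neg:A\to A$ such that $\neg 0\oplus x=\neg 0$ and $\neg(\neg x\oplus y)\oplus y=\neg(\neg y\oplus x)\oplus x$ for all $x,y\in A$; its order is $x\le y$ iff $\neg x\oplus y=\neg 0$. It is non-trivial if $0\ne\neg 0$, and is an MV-chain if its order is total. The real unit interval $[0,1]$ is an MV-algebra with $x\oplus y=\min\{x+y,1\}$, $\neg x=1-x$ and identity element $0$; for $n\ge2$, $\mathrm{L}_n=\{0,\frac{1}{n-1},\dots,\frac{n-2}{n-1},1\}$ is a subalgebra of $[0,1]$. An MV-algebra is profinite if it is isomorphic to an inverse limit of an inverse system of finite MV-algebras indexed by a directed poset. *)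

theory Defs
  imports Complex_Main "HOL-Algebra.Group" "HOL-Library.Infinite_Typeclass"
begin

text \<open>
  An MV-algebra is an Abelian monoid with a negation.  The monoid part is the library's
  monoid record; its operation and its identity element are written additively here.
\<close>

record 'a mv = "'a monoid" +
  mv_neg :: "'a \<Rightarrow> 'a" (\<open>\<sim>\<index> _\<close> [81] 80)

abbreviation mv_plus :: "('a, 'm) mv_scheme \<Rightarrow> 'a \<Rightarrow> 'a \<Rightarrow> 'a" (infixl \<open>\<oplus>\<index>\<close> 65)
  where "x \<oplus>\<^bsub>A\<^esub> y \<equiv> mult A x y"

abbreviation mv_zero :: "('a, 'm) mv_scheme \<Rightarrow> 'a" (\<open>\<zero>\<index>\<close>)
  where "\<zero>\<^bsub>A\<^esub> \<equiv> one A"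

locale mv_algebra = comm_monoid A for A :: "('a, 'm) mv_scheme" (structure) +
  assumes neg_closed: "x \<in> carrier A \<Longrightarrow> \<sim> x \<in> carrier A"
    and neg_neg: "x \<in> carrier A \<Longrightarrow> \<sim> (\<sim> x) = x"
    and neg_zero_plus: "x \<in> carrier A \<Longrightarrow> \<sim> \<zero> \<oplus> x = \<sim> \<zero>"
    and lukasiewicz: "\<lbrakk>x \<in> carrier A; y \<in> carrier A\<rbrakk>
      \<Longrightarrow> \<sim> (\<sim> x \<oplus> y) \<oplus> y = \<sim> (\<sim> y \<oplus> x) \<oplus> x"

definition mv_le :: "('a, 'm) mv_scheme \<Rightarrow> 'a \<Rightarrow> 'a \<Rightarrow> bool" (infix \<open>\<preceq>\<index>\<close> 50)
  where "x \<preceq>\<^bsub>A\<^esub> y \<longleftrightarrow> \<sim>\<^bsub>A\<^esub> x \<oplus>\<^bsub>A\<^esub> y = \<sim>\<^bsub>A\<^esub> \<zero>\<^bsub>A\<^esub>"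

locale mv_chain = mv_algebra +
  assumes total: "\<lbrakk>x \<in> carrier A; y \<in> carrier A\<rbrakk> \<Longrightarrow> x \<preceq> y \<or> y \<preceq> x"

definition mv_nontrivial :: "('a, 'm) mv_scheme \<Rightarrow> bool"
  where "mv_nontrivial A \<longleftrightarrow> \<zero>\<^bsub>A\<^esub> \<noteq> \<sim>\<^bsub>A\<^esub> \<zero>\<^bsub>A\<^esub>"

definition mv_hom :: "('a, 'm) mv_scheme \<Rightarrow> ('b, 'n) mv_scheme \<Rightarrow> ('a \<Rightarrow> 'b) set"
  where "mv_hom A B = {h \<in> hom A B. h \<zero>\<^bsub>A\<^esub> = \<zero>\<^bsub>B\<^esub> \<and>
    (\<forall>x\<in>carrier A. h (\<sim>\<^bsub>A\<^esub> x) = \<sim>\<^bsub>B\<^esub> (h x))}"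

definition mv_isomorphic :: "('a, 'm) mv_scheme \<Rightarrow> ('b, 'n) mv_scheme \<Rightarrow> bool"
    (infix \<open>\<cong>\<^sub>M\<^sub>V\<close> 60)
  where "A \<cong>\<^sub>M\<^sub>V B \<longleftrightarrow> (\<exists>h \<in> mv_hom A B. bij_betw h (carrier A) (carrier B))"

definition mv_unit_interval :: "real mv"
  where "mv_unit_interval =
    \<lparr>carrier = {0..1}, mult = (\<lambda>x y. min (x + y) 1), one = 0, mv_neg = (\<lambda>x. 1 - x)\<rparr>"

definition mv_L :: "nat \<Rightarrow> real mv"
  where "mv_L n = mv_unit_interval\<lparr>carrier := {real k / (real n - 1) | k. k < n}\<rparr>"

text \<open>
  A pair \<open>(i, j)\<close> in \<open>r\<close> means that \<open>i\<close> is below \<open>j\<close>; the transition map \<open>\<phi> i j\<close> then goes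
  from the algebra at \<open>j\<close> to the algebra at \<open>i\<close>.
\<close>

definition directed_poset :: "'i set \<Rightarrow> ('i \<times> 'i) set \<Rightarrow> bool"
  where "directed_poset I r \<longleftrightarrow> partial_order_on I r \<and> I \<noteq> {} \<and>
    (\<forall>i\<in>I. \<forall>j\<in>I. \<exists>k\<in>I. (i, k) \<in> r \<and> (j, k) \<in> r)"

locale mv_inverse_system =
  fixes I :: "'i set" and r :: "('i \<times> 'i) set"
    and F :: "'i \<Rightarrow> 'b mv" and \<phi> :: "'i \<Rightarrow> 'i \<Rightarrow> 'b \<Rightarrow> 'b"
  assumes directed: "directed_poset I r"
    and algebra: "i \<in> I \<Longrightarrow> mv_algebra (F i)"
    and hom: "(i, j) \<in> r \<Longrightarrow> \<phi> i j \<in> mv_hom (F j) (F i)"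
    and ident: "\<lbrakk>i \<in> I; x \<in> carrier (F i)\<rbrakk> \<Longrightarrow> \<phi> i i x = x"
    and comp: "\<lbrakk>(i, j) \<in> r; (j, k) \<in> r; x \<in> carrier (F k)\<rbrakk> \<Longrightarrow> \<phi> i j (\<phi> j k x) = \<phi> i k x"

definition mv_inverse_limit ::
    "'i set \<Rightarrow> ('i \<times> 'i) set \<Rightarrow> ('i \<Rightarrow> 'b mv) \<Rightarrow> ('i \<Rightarrow> 'i \<Rightarrow> 'b \<Rightarrow> 'b) \<Rightarrow> ('i \<Rightarrow> 'b) mv"
  where "mv_inverse_limit I r F \<phi> =
    \<lparr>carrier = {x \<in> (\<Pi>\<^sub>E i\<in>I. carrier (F i)). \<forall>(i, j)\<in>r. \<phi> i j (x j) = x i},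
     mult = (\<lambda>x y. \<lambda>i\<in>I. x i \<oplus>\<^bsub>F i\<^esub> y i),
     one = (\<lambda>i\<in>I. \<zero>\<^bsub>F i\<^esub>),
     mv_neg = (\<lambda>x. \<lambda>i\<in>I. \<sim>\<^bsub>F i\<^esub> (x i))\<rparr>"

text \<open>
  HOL cannot quantify existentially over types, so profiniteness is relative to the type \<open>'i\<close>
  from which the index set is taken and the type \<open>'b\<close> from which the elements of the finite
  algebras are taken.  A theorem in which \<open>'i\<close> and \<open>'b\<close> are type variables holds for all
  choices.  If \<open>'b\<close> is infinite it contains a copy of every finite algebra.
\<close>

definition mv_profinite :: "'i itself \<Rightarrow> 'b itself \<Rightarrow> ('a, 'm) mv_scheme \<Rightarrow> bool"
  where "mv_profinite (TYPE('i)) (TYPE('b)) A \<longleftrightarrow>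
    (\<exists>(I :: 'i set) r (F :: 'i \<Rightarrow> 'b mv) \<phi>. mv_inverse_system I r F \<phi> \<and>
      (\<forall>i\<in>I. finite (carrier (F i))) \<and> A \<cong>\<^sub>M\<^sub>V mv_inverse_limit I r F \<phi>)"

lemma mv_algebra_unit_interval: "mv_algebra mv_unit_interval"
  by unfold_locales (auto simp: mv_unit_interval_def min_def)

lemma mv_algebra_L:
  assumes "n \<ge> 2" shows "mv_algebra (mv_L n)"
proof -
  have c: "carrier (mv_L n) = {real k / (real n - 1) | k. k < n}"
    and ops: "mult (mv_L n) = (\<lambda>x y. min (x + y) 1)" "one (mv_L n) = 0"
      "mv_neg (mv_L n) = (\<lambda>x. 1 - x)"
    by (simp_all add: mv_L_def mv_unit_interval_def)
  have sub: "0 \<le> x \<and> x \<le> 1" if "x \<in> carrier (mv_L n)" for x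
    using that assms by (auto simp: c divide_le_eq_1)
  have plus: "min (x + y) 1 \<in> carrier (mv_L n)"
    if xy: "x \<in> carrier (mv_L n)" "y \<in> carrier (mv_L n)" for x y
  proof -
    obtain k l where k: "k < n" "x = real k / (real n - 1)" and l: "l < n" "y = real l / (real n - 1)"
      using xy unfolding c by blast
    have "min (x + y) 1 = real (min (k + l) (n - 1)) / (real n - 1)"
    proof -
      have p: "real n - 1 > 0" and d: "real (n - 1) = real n - 1"
        using assms by (auto simp: of_nat_diff)
      have s: "x + y = real (k + l) / (real n - 1)" by (simp add: k l add_divide_distrib)
      show ?thesis
      proof (cases "k + l \<le> n - 1")
        case True
        then have "real (k + l) \<le> real n - 1" using d by (metis of_nat_le_iff)
        then have "x + y \<le> 1" using p by (simp add: s)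
        then show ?thesis using True s by (simp add: min_def)
      next
        case False
        then have "real (k + l) > real n - 1" using d by (metis not_le of_nat_less_iff)
        then have "x + y > 1" using p by (simp add: s)
        then show ?thesis using False p d by (simp add: min_def)
      qed
    qed
    then show ?thesis using assms by (auto simp: c intro!: exI[of _ "min (k + l) (n - 1)"])
  qed
  have neg: "1 - x \<in> carrier (mv_L n)" if x: "x \<in> carrier (mv_L n)" for x
  proof -
    obtain k where k: "k < n" "x = real k / (real n - 1)" using x unfolding c by blast
    have "1 - x = real (n - 1 - k) / (real n - 1)"
      using assms k by (simp add: of_nat_diff field_simps)
    then show ?thesis using assms by (auto simp: c intro!: exI[of _ "n - 1 - k"])
  qed
  have zero: "0 \<in> carrier (mv_L n)" using assms by (auto simp: c intro!: exI[of _ 0])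
  show ?thesis
    by unfold_locales (simp_all add: ops plus neg zero, auto simp: min_def dest!: sub)
qed

lemma (in mv_inverse_system) mv_algebra_inverse_limit: "mv_algebra (mv_inverse_limit I r F \<phi>)"
proof -
  let ?L = "mv_inverse_limit I r F \<phi>"
  have r: "i \<in> I" "j \<in> I" if "(i, j) \<in> r" for i j
    using that directed by (auto simp: directed_poset_def partial_order_on_def preorder_on_def)
  have m: "comm_monoid (F i)" "monoid (F i)" if "i \<in> I" for i
    using algebra[OF that] mv_algebra.axioms(1) comm_monoid.axioms(1) by blast+
  note ops = mv_inverse_limit_def
  have comp: "x i \<in> carrier (F i)" if "x \<in> carrier ?L" "i \<in> I" for x i
    using that by (auto simp: ops)
  have compat: "\<phi> i j (x j) = x i" if "x \<in> carrier ?L" "(i, j) \<in> r" for x i j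
    using that by (auto simp: ops)
  have eq: "x = y" if "x \<in> extensional I" "y \<in> extensional I" "\<And>i. i \<in> I \<Longrightarrow> x i = y i" for x y :: "'i \<Rightarrow> 'b"
    using that by (rule extensionalityI)
  have ext: "x \<in> extensional I" if "x \<in> carrier ?L" for x
    using that by (auto simp: ops PiE_def)
  show ?thesis
  proof unfold_locales
    fix x y assume xy: "x \<in> carrier ?L" "y \<in> carrier ?L"
    have "\<phi> i j (x j \<oplus>\<^bsub>F j\<^esub> y j) = x i \<oplus>\<^bsub>F i\<^esub> y i" if "(i, j) \<in> r" for i j
      using hom[OF that] comp[OF xy(1) r(2)[OF that]] comp[OF xy(2) r(2)[OF that]]
        compat[OF xy(1) that] compat[OF xy(2) that]
      by (simp add: mv_hom_def hom_def)
    then show "x \<oplus>\<^bsub>?L\<^esub> y \<in> carrier ?L"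
      using comp[OF xy(1)] comp[OF xy(2)] r m(2) by (auto simp: ops intro!: monoid.m_closed)
    show "x \<oplus>\<^bsub>?L\<^esub> y = y \<oplus>\<^bsub>?L\<^esub> x"
      using comp[OF xy(1)] comp[OF xy(2)] m(1)
      by (auto simp: ops intro!: restrict_ext comm_monoid.m_comm)
    show "\<sim>\<^bsub>?L\<^esub> (\<sim>\<^bsub>?L\<^esub> x \<oplus>\<^bsub>?L\<^esub> y) \<oplus>\<^bsub>?L\<^esub> y = \<sim>\<^bsub>?L\<^esub> (\<sim>\<^bsub>?L\<^esub> y \<oplus>\<^bsub>?L\<^esub> x) \<oplus>\<^bsub>?L\<^esub> x"
      using comp[OF xy(1)] comp[OF xy(2)] algebra
      by (auto simp: ops intro!: restrict_ext mv_algebra.lukasiewicz)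
  next
    fix x y z assume xyz: "x \<in> carrier ?L" "y \<in> carrier ?L" "z \<in> carrier ?L"
    show "x \<oplus>\<^bsub>?L\<^esub> y \<oplus>\<^bsub>?L\<^esub> z = x \<oplus>\<^bsub>?L\<^esub> (y \<oplus>\<^bsub>?L\<^esub> z)"
      using comp[OF xyz(1)] comp[OF xyz(2)] comp[OF xyz(3)] m(2)
      by (auto simp: ops intro!: restrict_ext monoid.m_assoc)
  next
    have "\<phi> i j \<zero>\<^bsub>F j\<^esub> = \<zero>\<^bsub>F i\<^esub>" if "(i, j) \<in> r" for i j
      using hom[OF that] by (auto simp: mv_hom_def)
    then show "\<zero>\<^bsub>?L\<^esub> \<in> carrier ?L"
      using r m(2) by (auto simp: ops intro!: monoid.one_closed)
  next
    fix x assume x: "x \<in> carrier ?L"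
    show "\<zero>\<^bsub>?L\<^esub> \<oplus>\<^bsub>?L\<^esub> x = x"
      by (rule eq) (use ext[OF x] comp[OF x] m(2) in \<open>auto simp: ops intro!: monoid.l_one\<close>)
    show "x \<oplus>\<^bsub>?L\<^esub> \<zero>\<^bsub>?L\<^esub> = x"
      by (rule eq) (use ext[OF x] comp[OF x] m(2) in \<open>auto simp: ops intro!: monoid.r_one\<close>)
    have "\<phi> i j (\<sim>\<^bsub>F j\<^esub> (x j)) = \<sim>\<^bsub>F i\<^esub> (x i)" if "(i, j) \<in> r" for i j
      using hom[OF that] comp[OF x r(2)[OF that]] compat[OF x that] by (simp add: mv_hom_def)
    then show "\<sim>\<^bsub>?L\<^esub> x \<in> carrier ?L"
      using comp[OF x] r algebra by (auto simp: ops intro!: mv_algebra.neg_closed)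
    show "\<sim>\<^bsub>?L\<^esub> (\<sim>\<^bsub>?L\<^esub> x) = x"
      by (rule eq) (use ext[OF x] comp[OF x] algebra in \<open>auto simp: ops intro!: mv_algebra.neg_neg\<close>)
    show "\<sim>\<^bsub>?L\<^esub> \<zero>\<^bsub>?L\<^esub> \<oplus>\<^bsub>?L\<^esub> x = \<sim>\<^bsub>?L\<^esub> \<zero>\<^bsub>?L\<^esub>"
      using comp[OF x] algebra by (auto simp: ops intro!: restrict_ext mv_algebra.neg_zero_plus)
  qed
qed

end

theory Submission
  imports Defs
begin

text \<open>
  Let a chain \<open>A\<close> be the limit of finite algebras \<open>F i\<close>. In the image of \<open>A\<close> in \<open>F j\<close>, some multiple
  of any element is idempotent, hence \<open>0\<close> or \<open>1\<close>. So an element that is nonzero in \<open>F j\<close> has a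
  multiple that is \<open>1\<close> in \<open>F j\<close>, hence in each \<open>F i\<close> with \<open>i\<close> below \<open>j\<close>, and it cannot vanish in
  a nontrivial such \<open>F i\<close>. By directedness \<open>A\<close> embeds into any nontrivial \<open>F i\<close>, so \<open>A\<close> is finite.
  In a finite chain, \<open>y \<mapsto> x \<oplus> y\<close> is an order isomorphism from \<open>[0, \<sim> x]\<close> to \<open>[x, 1]\<close>, so the rank
  (the number of strictly smaller elements) is truncated additive and gives the isomorphism with
  \<open>L\<^sub>n\<close>. Conversely, a finite algebra is the limit of a system with a single index.
\<close>

section \<open>Order and truncated difference in an MV-algebra\<close>

context mv_algebra
begin

lemma plus_top: "x \<in> carrier A \<Longrightarrow> x \<oplus> \<sim> \<zero> = \<sim> \<zero>"
  by (metis m_comm neg_closed neg_zero_plus one_closed)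

text \<open>The \<open>lukasiewicz\<close> axiom at \<open>y = \<sim> \<zero>\<close>: its left side
  is absorbed to the top, its right side collapses to \<open>\<sim> x \<oplus> x\<close>.\<close>

lemma plus_neg: "x \<in> carrier A \<Longrightarrow> x \<oplus> \<sim> x = \<sim> \<zero>"
  using lukasiewicz[of x "\<sim> \<zero>"] by (simp add: neg_closed neg_neg plus_top m_comm[of x])

lemma le_refl: "x \<in> carrier A \<Longrightarrow> x \<preceq> x"
  by (simp add: mv_le_def m_comm neg_closed plus_neg)

lemma le_antisym:
  assumes "x \<in> carrier A" "y \<in> carrier A" "x \<preceq> y" "y \<preceq> x" shows "x = y"
  using lukasiewicz[of x y] assms by (simp add: mv_le_def neg_neg)

text \<open>The term \<open>\<sim> (\<sim> y \<oplus> x)\<close> is the truncated difference of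
  \<open>y\<close> and \<open>x\<close>. Both sides of \<open>lukasiewicz\<close> express the join
  of \<open>x\<close> and \<open>y\<close>, and \<open>x \<preceq> y\<close> turns the left side
  into \<open>y\<close>.\<close>

lemma le_imp_plus_diff:
  assumes "x \<in> carrier A" "y \<in> carrier A" "x \<preceq> y" shows "x \<oplus> \<sim> (\<sim> y \<oplus> x) = y"
  using lukasiewicz[of x y] assms by (simp add: mv_le_def neg_neg neg_closed m_comm)

lemma le_plus: "\<lbrakk>x \<in> carrier A; y \<in> carrier A\<rbrakk> \<Longrightarrow> x \<preceq> x \<oplus> y"
  unfolding mv_le_def by (metis m_assoc m_comm neg_closed neg_zero_plus plus_neg)

text \<open>The order is the divisibility order of the monoid, with the truncated difference as
  witness. Transitivity and monotonicity thereby reduce to associativity.\<close>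

lemma le_iff_plus:
  assumes "x \<in> carrier A" "y \<in> carrier A"
  shows "x \<preceq> y \<longleftrightarrow> (\<exists>c\<in>carrier A. y = x \<oplus> c)"
proof
  assume "x \<preceq> y"
  with assms show "\<exists>c\<in>carrier A. y = x \<oplus> c"
    by (intro bexI[of _ "\<sim> (\<sim> y \<oplus> x)"]) (simp_all add: le_imp_plus_diff neg_closed)
qed (use assms le_plus in blast)

lemma le_trans:
  assumes c: "x \<in> carrier A" "y \<in> carrier A" "z \<in> carrier A" and "x \<preceq> y" "y \<preceq> z"
  shows "x \<preceq> z"
proof -
  obtain d e where "d \<in> carrier A" "y = x \<oplus> d" "e \<in> carrier A" "z = y \<oplus> e"
    using assms by (auto simp: le_iff_plus)
  then have "z = x \<oplus> (d \<oplus> e)" "d \<oplus> e \<in> carrier A"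
    using c by (simp_all add: m_assoc)
  then show ?thesis using c le_plus by simp
qed

lemma plus_mono:
  assumes c: "x \<in> carrier A" "y \<in> carrier A" "z \<in> carrier A" and "y \<preceq> z"
  shows "x \<oplus> y \<preceq> x \<oplus> z"
proof -
  obtain d where "d \<in> carrier A" "z = y \<oplus> d"
    using assms by (auto simp: le_iff_plus)
  then show ?thesis using c le_plus[of "x \<oplus> y" d] by (simp add: m_assoc)
qed

lemma neg_antimono: "\<lbrakk>x \<in> carrier A; y \<in> carrier A; x \<preceq> y\<rbrakk> \<Longrightarrow> \<sim> y \<preceq> \<sim> x"
  by (simp add: mv_le_def neg_neg neg_closed m_comm)

lemma diff_mono:
  assumes "x \<in> carrier A" "y \<in> carrier A" "z \<in> carrier A" "y \<preceq> z"
  shows "\<sim> (\<sim> y \<oplus> x) \<preceq> \<sim> (\<sim> z \<oplus> x)"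
  using assms plus_mono[of x "\<sim> z" "\<sim> y"] by (simp add: neg_antimono neg_closed m_comm)

text \<open>The condition \<open>y \<preceq> \<sim> x\<close> says that no truncation occurs in
  \<open>x \<oplus> y\<close>. The negated claim is one side of \<open>lukasiewicz\<close> for
  \<open>\<sim> y\<close> and \<open>x\<close>, and under this condition the other side is
  \<open>\<sim> y\<close>.\<close>

lemma plus_diff_cancel:
  assumes "x \<in> carrier A" "y \<in> carrier A" "y \<preceq> \<sim> x"
  shows "\<sim> (\<sim> (x \<oplus> y) \<oplus> x) = y"
proof -
  have "\<sim> (x \<oplus> y) \<oplus> x = \<sim> (\<sim> (\<sim> y) \<oplus> x) \<oplus> x"
    using assms by (simp add: neg_neg m_comm)
  also have "\<dots> = \<sim> (\<sim> x \<oplus> \<sim> y) \<oplus> \<sim> y"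
    using assms by (intro lukasiewicz neg_closed)
  also have "\<dots> = \<sim> y"
    using assms by (simp add: mv_le_def m_comm neg_closed neg_neg)
  finally show ?thesis using assms by (simp add: neg_neg)
qed

text \<open>If \<open>\<sim> e \<preceq> e\<close>, then \<open>e = e \<oplus> e\<close> is the top.
  If \<open>e \<preceq> \<sim> e\<close>, cancelling \<open>e\<close> from
  \<open>e \<oplus> e = e\<close> leaves \<open>\<zero>\<close>. Comparability is asked of
  \<open>e\<close> and \<open>\<sim> e\<close> alone, so that the lemma applies to images of
  chains.\<close>

lemma idempotent_cases:
  assumes e: "e \<in> carrier A" "e \<oplus> e = e" and "e \<preceq> \<sim> e \<or> \<sim> e \<preceq> e"
  shows "e = \<zero> \<or> e = \<sim> \<zero>"
  using assms(3)
proof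
  assume "\<sim> e \<preceq> e"
  then show ?thesis using e by (simp add: mv_le_def neg_neg)
next
  assume "e \<preceq> \<sim> e"
  then have "e = \<sim> (\<sim> \<zero>)"
    using plus_diff_cancel[of e e] e plus_neg[of e] by (simp add: m_comm neg_closed)
  then show ?thesis by (simp add: neg_neg)
qed

end

text \<open>The powers of \<open>x\<close> repeat, so from some exponent \<open>a\<close> on they
  are periodic with a period \<open>p\<close>. An exponent that is a positive multiple of
  \<open>p\<close> and at least \<open>a\<close> is unchanged by doubling.\<close>

lemma (in monoid) finite_imp_idempotent_pow:
  assumes "finite (carrier G)" and x: "x \<in> carrier G"
  shows "\<exists>n::nat. n > 0 \<and> x [^] n \<otimes> x [^] n = x [^] n"
proof -
  have "finite (range (\<lambda>n::nat. x [^] n))"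
    using assms by (auto intro: finite_subset)
  then have "\<not> inj (\<lambda>n::nat. x [^] n)"
    using finite_imageD by blast
  then obtain a b :: nat where ab: "a < b" "x [^] a = x [^] b"
    by (metis injI linorder_neqE_nat)
  define p where "p = b - a"
  have p: "p > 0" "x [^] (a + p) = x [^] a" using ab by (auto simp: p_def)
  have step: "x [^] (m + p) = x [^] m" if "m \<ge> a" for m
  proof -
    have "x [^] (m + p) = x [^] (a + p) \<otimes> x [^] (m - a)"
      using that x by (simp add: nat_pow_mult) (simp add: add.commute)
    also have "\<dots> = x [^] m"
      using that x unfolding p(2) by (simp add: nat_pow_mult)
    finally show ?thesis .
  qed
  have steps: "x [^] (m + k * p) = x [^] m" if "m \<ge> a" for m k
  proof (induction k)
    case (Suc k)
    then show ?case using that step[of "m + k * p"] by (simp add: add.assoc add.commute[of p])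
  qed simp
  \<comment> \<open>The factor \<open>Suc a\<close> makes \<open>?n\<close> positive and at least
    \<open>a\<close>; doubling \<open>?n\<close> adds \<open>Suc a\<close> periods.\<close>
  let ?n = "Suc a * p"
  have "a \<le> ?n" using p(1) by (cases p) auto
  then have "x [^] ?n \<otimes> x [^] ?n = x [^] ?n"
    using x steps[of ?n "Suc a"] by (simp add: nat_pow_mult)
  moreover have "?n > 0" using p(1) by simp
  ultimately show ?thesis by blast
qed

section \<open>Homomorphisms and kernels\<close>

lemma mv_homD:
  assumes "h \<in> mv_hom A B"
  shows "x \<in> carrier A \<Longrightarrow> h x \<in> carrier B"
    and "\<lbrakk>x \<in> carrier A; y \<in> carrier A\<rbrakk> \<Longrightarrow> h (x \<oplus>\<^bsub>A\<^esub> y) = h x \<oplus>\<^bsub>B\<^esub> h y"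
    and "h \<zero>\<^bsub>A\<^esub> = \<zero>\<^bsub>B\<^esub>"
    and "x \<in> carrier A \<Longrightarrow> h (\<sim>\<^bsub>A\<^esub> x) = \<sim>\<^bsub>B\<^esub> (h x)"
  using assms by (auto simp: mv_hom_def hom_def)

lemma mv_homI:
  assumes "\<And>x. x \<in> carrier A \<Longrightarrow> h x \<in> carrier B"
    and "\<And>x y. \<lbrakk>x \<in> carrier A; y \<in> carrier A\<rbrakk> \<Longrightarrow> h (x \<oplus>\<^bsub>A\<^esub> y) = h x \<oplus>\<^bsub>B\<^esub> h y"
    and "h \<zero>\<^bsub>A\<^esub> = \<zero>\<^bsub>B\<^esub>"
    and "\<And>x. x \<in> carrier A \<Longrightarrow> h (\<sim>\<^bsub>A\<^esub> x) = \<sim>\<^bsub>B\<^esub> (h x)"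
  shows "h \<in> mv_hom A B"
  using assms by (auto simp: mv_hom_def hom_def)

lemma mv_hom_le:
  assumes "mv_algebra A" "h \<in> mv_hom A B" "x \<in> carrier A" "y \<in> carrier A" "x \<preceq>\<^bsub>A\<^esub> y"
  shows "h x \<preceq>\<^bsub>B\<^esub> h y"
proof -
  interpret mv_algebra A by fact
  show ?thesis
    using assms mv_homD[OF assms(2)] by (metis mv_le_def neg_closed one_closed)
qed

lemma mv_hom_pow:
  assumes "monoid A" "monoid B" "h \<in> mv_hom A B" "x \<in> carrier A"
  shows "h (x [^]\<^bsub>A\<^esub> (n::nat)) = h x [^]\<^bsub>B\<^esub> n"
proof (induction n)
  case (Suc n)
  then show ?case
    using assms mv_homD[OF assms(3)] by (simp add: monoid.nat_pow_closed)
qed (use mv_homD(3)[OF assms(3)] in simp)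

text \<open>If \<open>h x = h y\<close>, both truncated differences of \<open>x\<close> and
  \<open>y\<close> lie in the kernel. A vanishing difference means \<open>\<preceq>\<close>, so
  antisymmetry applies.\<close>

lemma mv_hom_inj_onI:
  assumes "mv_algebra A" "mv_algebra B" and h: "h \<in> mv_hom A B"
    and ker: "\<And>x. \<lbrakk>x \<in> carrier A; h x = \<zero>\<^bsub>B\<^esub>\<rbrakk> \<Longrightarrow> x = \<zero>\<^bsub>A\<^esub>"
  shows "inj_on h (carrier A)"
proof (rule inj_onI)
  interpret A: mv_algebra A by fact
  interpret B: mv_algebra B by fact
  have le: "x \<preceq>\<^bsub>A\<^esub> y" if c: "x \<in> carrier A" "y \<in> carrier A" and eq: "h x = h y" for x y
  proof -
    have "h (\<sim>\<^bsub>A\<^esub> (\<sim>\<^bsub>A\<^esub> x \<oplus>\<^bsub>A\<^esub> y)) = \<zero>\<^bsub>B\<^esub>"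
      using c eq mv_homD[OF h] B.le_refl[of "h y"]
      by (simp add: A.neg_closed B.neg_neg mv_le_def)
    then have "\<sim>\<^bsub>A\<^esub> (\<sim>\<^bsub>A\<^esub> x \<oplus>\<^bsub>A\<^esub> y) = \<zero>\<^bsub>A\<^esub>"
      using c by (intro ker A.neg_closed A.m_closed)
    then show ?thesis
      using c by (metis A.m_closed A.neg_closed A.neg_neg mv_le_def)
  qed
  fix x y assume "x \<in> carrier A" "y \<in> carrier A" "h x = h y"
  then show "x = y" by (intro A.le_antisym le) auto
qed

section \<open>Finiteness of a chain that is a limit of finite algebras\<close>

text \<open>Some positive multiple of \<open>p x\<close> is idempotent, hence zero or top. It is not
  the top, since \<open>q\<close> kills it and \<open>C\<close> is nontrivial; so it is zero, and
  \<open>p x\<close> lies below it.\<close>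

lemma mv_chain_hom_kernel:
  assumes A: "mv_chain A" and B: "mv_algebra B" "finite (carrier B)"
    and C: "mv_algebra C" "mv_nontrivial C"
    and p: "p \<in> mv_hom A B" and q: "q \<in> mv_hom B C"
    and x: "x \<in> carrier A" and q0: "q (p x) = \<zero>\<^bsub>C\<^esub>"
  shows "p x = \<zero>\<^bsub>B\<^esub>"
proof -
  interpret A: mv_chain A by fact
  interpret B: mv_algebra B by fact
  interpret C: mv_algebra C by fact
  have px: "p x \<in> carrier B" using mv_homD(1)[OF p x] .
  \<comment> \<open>The monoid is written additively, so \<open>[^]\<close> denotes the
    \<open>n\<close>-fold sum.\<close>
  obtain n :: nat where n: "n > 0"
    "p x [^]\<^bsub>B\<^esub> n \<oplus>\<^bsub>B\<^esub> p x [^]\<^bsub>B\<^esub> n = p x [^]\<^bsub>B\<^esub> n"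
    using B.finite_imp_idempotent_pow[OF B(2) px] by blast
  define y where "y = x [^]\<^bsub>A\<^esub> n"
  have y: "y \<in> carrier A" using x by (simp add: y_def)
  have py: "p y = p x [^]\<^bsub>B\<^esub> n"
    unfolding y_def by (rule mv_hom_pow[OF A.monoid_axioms B.monoid_axioms p x])
  \<comment> \<open>Comparability with the negation holds in the chain \<open>A\<close> and is
    carried to \<open>B\<close> by \<open>p\<close>.\<close>
  have "y \<preceq>\<^bsub>A\<^esub> \<sim>\<^bsub>A\<^esub> y \<or> \<sim>\<^bsub>A\<^esub> y \<preceq>\<^bsub>A\<^esub> y" using y by (intro A.total A.neg_closed)
  then have "p y \<preceq>\<^bsub>B\<^esub> \<sim>\<^bsub>B\<^esub> (p y) \<or> \<sim>\<^bsub>B\<^esub> (p y) \<preceq>\<^bsub>B\<^esub> p y"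
    using mv_hom_le[OF A.mv_algebra_axioms p] y mv_homD(4)[OF p y] A.neg_closed by metis
  then have "p y = \<zero>\<^bsub>B\<^esub> \<or> p y = \<sim>\<^bsub>B\<^esub> \<zero>\<^bsub>B\<^esub>"
    using n py mv_homD(1)[OF p y] by (intro B.idempotent_cases) auto
  moreover have "p y \<noteq> \<sim>\<^bsub>B\<^esub> \<zero>\<^bsub>B\<^esub>"
  proof
    assume "p y = \<sim>\<^bsub>B\<^esub> \<zero>\<^bsub>B\<^esub>"
    then have "q (p y) = \<sim>\<^bsub>C\<^esub> \<zero>\<^bsub>C\<^esub>" using mv_homD[OF q] by simp
    moreover have "q (p y) = q (p x) [^]\<^bsub>C\<^esub> n"
      unfolding py by (rule mv_hom_pow[OF B.monoid_axioms C.monoid_axioms q px])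
    ultimately show False using q0 C(2) by (simp add: mv_nontrivial_def)
  qed
  ultimately have y0: "p x [^]\<^bsub>B\<^esub> n = \<zero>\<^bsub>B\<^esub>" using py by simp
  obtain m where "n = Suc m" using n(1) gr0_implies_Suc by blast
  then have "p x \<preceq>\<^bsub>B\<^esub> \<zero>\<^bsub>B\<^esub>"
    using y0 px B.le_plus[of "p x" "p x [^]\<^bsub>B\<^esub> m"] by (simp add: B.m_comm)
  moreover have "\<zero>\<^bsub>B\<^esub> \<preceq>\<^bsub>B\<^esub> p x" using px B.le_plus[of "\<zero>\<^bsub>B\<^esub>" "p x"] by simp
  ultimately show ?thesis using px by (intro B.le_antisym) auto
qed

lemma mv_chain_inverse_limit_finite:
  fixes A :: "('a, 'm) mv_scheme"
  assumes A: "mv_chain A" "mv_nontrivial A" and sys: "mv_inverse_system I r F \<phi>"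
    and fin: "\<And>i. i \<in> I \<Longrightarrow> finite (carrier (F i))"
    and iso: "A \<cong>\<^sub>M\<^sub>V mv_inverse_limit I r F \<phi>"
  shows "finite (carrier A)"
proof -
  interpret A: mv_chain A by fact
  interpret mv_inverse_system I r F \<phi> by fact
  let ?L = "mv_inverse_limit I r F \<phi>"
  obtain g where g: "g \<in> mv_hom A ?L" and bij: "bij_betw g (carrier A) (carrier ?L)"
    using iso by (auto simp: mv_isomorphic_def)
  have gL: "g x \<in> carrier ?L" if "x \<in> carrier A" for x using mv_homD(1)[OF g that] .
  have g_ext: "g x \<in> extensional I" if "x \<in> carrier A" for x
    using gL[OF that] by (auto simp: mv_inverse_limit_def PiE_def)
  have g_eqI: "x = y"
    if "x \<in> carrier A" "y \<in> carrier A" "\<And>i. i \<in> I \<Longrightarrow> g x i = g y i" for x y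
    using that g_ext bij by (metis bij_betw_imp_inj_on inj_onD extensionalityI)
  have p: "(\<lambda>x. g x i) \<in> mv_hom A (F i)" if i: "i \<in> I" for i
    by (rule mv_homI) (use i mv_homD[OF g] gL in \<open>auto simp: mv_inverse_limit_def\<close>)
  have compat: "\<phi> i j (g x j) = g x i" if "x \<in> carrier A" "(i, j) \<in> r" for x i j
    using gL[OF that(1)] that(2) by (auto simp: mv_inverse_limit_def)
  \<comment> \<open>Otherwise zero and top of \<open>A\<close> would agree in every
    coordinate.\<close>
  have "\<exists>i\<in>I. mv_nontrivial (F i)"
  proof (rule ccontr)
    assume "\<not> ?thesis"
    then have "g \<zero>\<^bsub>A\<^esub> i = g (\<sim>\<^bsub>A\<^esub> \<zero>\<^bsub>A\<^esub>) i" if "i \<in> I" for i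
      using that mv_homD(3,4)[OF p[OF that]] by (simp add: mv_nontrivial_def)
    then have "\<zero>\<^bsub>A\<^esub> = \<sim>\<^bsub>A\<^esub> \<zero>\<^bsub>A\<^esub>" by (intro g_eqI A.neg_closed) auto
    then show False using A(2) by (simp add: mv_nontrivial_def)
  qed
  then obtain i where i: "i \<in> I" "mv_nontrivial (F i)" by blast
  have "inj_on (\<lambda>x. g x i) (carrier A)"
  proof (rule mv_hom_inj_onI[OF A.mv_algebra_axioms algebra[OF i(1)] p[OF i(1)]])
    fix x assume x: "x \<in> carrier A" "g x i = \<zero>\<^bsub>F i\<^esub>"
    have zero: "g x k = \<zero>\<^bsub>F k\<^esub>" if k: "k \<in> I" for k
    proof -
      \<comment> \<open>The kernel lemma with \<open>q = \<phi> i j\<close> lifts the vanishing of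
        \<open>x\<close> from \<open>i\<close> up to \<open>j\<close>; the map
        \<open>\<phi> k j\<close> then brings it down to \<open>k\<close>.\<close>
      obtain j where j: "j \<in> I" "(i, j) \<in> r" "(k, j) \<in> r"
        using directed i(1) k by (auto simp: directed_poset_def)
      have "g x j = \<zero>\<^bsub>F j\<^esub>"
        using mv_chain_hom_kernel[OF A(1) algebra[OF j(1)] fin[OF j(1)] algebra[OF i(1)] i(2)
            p[OF j(1)] hom[OF j(2)] x(1)] compat[OF x(1) j(2)] x(2) by simp
      then show ?thesis
        using compat[OF x(1) j(3)] mv_homD(3)[OF hom[OF j(3)]] by simp
    qed
    show "x = \<zero>\<^bsub>A\<^esub>"
      by (rule g_eqI) (use x zero mv_homD(3)[OF p] in simp_all)
  qed
  moreover have "(\<lambda>x. g x i) ` carrier A \<subseteq> carrier (F i)"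
    using mv_homD(1)[OF p[OF i(1)]] by blast
  ultimately show ?thesis using fin[OF i(1)] inj_on_finite by blast
qed

section \<open>Ranks in a finite chain and the isomorphism with \<open>mv_L n\<close>\<close>

text \<open>In a finite chain this is the position counted from 0, which becomes the numerator of
  the corresponding fraction in \<open>mv_L n\<close>.\<close>

definition mv_rank :: "('a, 'm) mv_scheme \<Rightarrow> 'a \<Rightarrow> nat"
  where "mv_rank A x = card {y \<in> carrier A. y \<preceq>\<^bsub>A\<^esub> x \<and> y \<noteq> x}"

context mv_chain
begin

lemma rank_strict_mono:
  assumes fin: "finite (carrier A)" and c: "x \<in> carrier A" "y \<in> carrier A"
    and "x \<preceq> y" "x \<noteq> y"
  shows "mv_rank A x < mv_rank A y"
  unfolding mv_rank_def
proof (rule psubset_card_mono)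
  have "{z \<in> carrier A. z \<preceq> x \<and> z \<noteq> x} \<subseteq> {z \<in> carrier A. z \<preceq> y \<and> z \<noteq> y}"
    using assms le_trans le_antisym by blast
  then show "{z \<in> carrier A. z \<preceq> x \<and> z \<noteq> x} \<subset> {z \<in> carrier A. z \<preceq> y \<and> z \<noteq> y}"
    using assms by blast
qed (use fin in simp)

text \<open>Strict monotonicity on a chain gives injectivity, and no element precedes itself, which
  bounds the rank. Equal cardinalities then give surjectivity.\<close>

lemma bij_betw_rank:
  assumes "finite (carrier A)"
  shows "bij_betw (mv_rank A) (carrier A) {..<card (carrier A)}"
proof -
  have inj: "inj_on (mv_rank A) (carrier A)"
    using rank_strict_mono[OF assms] total by (metis inj_onI less_irrefl)
  have "mv_rank A x < card (carrier A)" if "x \<in> carrier A" for x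
    unfolding mv_rank_def by (rule psubset_card_mono) (use assms that in auto)
  then have "mv_rank A ` carrier A \<subseteq> {..<card (carrier A)}" by blast
  then show ?thesis
    using inj by (simp add: bij_betw_def card_image card_subset_eq)
qed

text \<open>The strict predecessors of \<open>x \<oplus> y\<close> are those of \<open>x\<close>
  together with the interval \<open>?M\<close> from \<open>x\<close> up to, but excluding,
  \<open>x \<oplus> y\<close>. Translation by \<open>x\<close> matches \<open>?M\<close> with the
  strict predecessors of \<open>y\<close>.\<close>

lemma rank_plus:
  assumes fin: "finite (carrier A)" and c: "x \<in> carrier A" "y \<in> carrier A" and yx: "y \<preceq> \<sim> x"
  shows "mv_rank A (x \<oplus> y) = mv_rank A x + mv_rank A y"
proof -
  let ?D = "\<lambda>u. {z \<in> carrier A. z \<preceq> u \<and> z \<noteq> u}"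
  let ?M = "{z \<in> carrier A. x \<preceq> z \<and> z \<preceq> x \<oplus> y \<and> z \<noteq> x \<oplus> y}"
  have "?D (x \<oplus> y) = ?D x \<union> ?M"
    using c total le_plus[of x y] le_trans[of _ x "x \<oplus> y"] le_antisym[of x] le_refl[of x] by fastforce
  moreover have "?D x \<inter> ?M = {}" using c le_antisym by blast
  moreover have "card ?M = card (?D y)"
  proof -
    have sub: "z \<preceq> \<sim> x" if "z \<in> carrier A" "z \<preceq> y" for z
      using that c yx le_trans neg_closed by blast
    \<comment> \<open>The inverse is subtraction of \<open>x\<close>; by \<open>sub\<close>, adding
      \<open>x\<close> to a predecessor of \<open>y\<close> is never truncated.\<close>
    have "bij_betw (\<lambda>z. x \<oplus> z) (?D y) ?M"
    proof (rule bij_betw_byWitness[where f' = "\<lambda>z. \<sim> (\<sim> z \<oplus> x)"])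
      show "\<forall>z\<in>?D y. \<sim> (\<sim> (x \<oplus> z) \<oplus> x) = z"
        using c sub plus_diff_cancel by simp
      show "\<forall>z\<in>?M. x \<oplus> \<sim> (\<sim> z \<oplus> x) = z"
        using c le_imp_plus_diff by simp
      show "(\<lambda>z. x \<oplus> z) ` ?D y \<subseteq> ?M"
      proof (rule image_subsetI)
        fix z assume "z \<in> ?D y"
        then have z: "z \<in> carrier A" "z \<preceq> y" "z \<noteq> y" by auto
        have "x \<oplus> z \<noteq> x \<oplus> y"
          using z(3) plus_diff_cancel[OF c(1) z(1) sub[OF z(1,2)]] plus_diff_cancel[OF c yx] by auto
        then show "x \<oplus> z \<in> ?M"
          using z(1) c le_plus[OF c(1) z(1)] plus_mono[OF c(1) z(1) c(2) z(2)] by simp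
      qed
      show "(\<lambda>z. \<sim> (\<sim> z \<oplus> x)) ` ?M \<subseteq> ?D y"
      proof (rule image_subsetI)
        fix z assume "z \<in> ?M"
        then have z: "z \<in> carrier A" "x \<preceq> z" "z \<preceq> x \<oplus> y" "z \<noteq> x \<oplus> y" by auto
        have "\<sim> (\<sim> z \<oplus> x) \<preceq> y"
          using z c yx diff_mono[of x z "x \<oplus> y"] plus_diff_cancel[of x y] by simp
        moreover have "\<sim> (\<sim> z \<oplus> x) \<noteq> y"
          using z(4) le_imp_plus_diff[OF c(1) z(1,2)] by auto
        ultimately show "\<sim> (\<sim> z \<oplus> x) \<in> ?D y"
          using z c by (simp add: neg_closed)
      qed
    qed
    then show ?thesis by (simp add: bij_betw_same_card)
  qed
  ultimately show ?thesis
    using fin by (simp add: mv_rank_def card_Un_disjoint)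
qed

lemma rank_zero: "mv_rank A \<zero> = 0"
proof -
  have "{y \<in> carrier A. y \<preceq> \<zero> \<and> y \<noteq> \<zero>} = {}"
    using le_antisym le_plus[of "\<zero>"] by fastforce
  then show ?thesis by (simp only: mv_rank_def card.empty)
qed

lemma rank_top: "mv_rank A (\<sim> \<zero>) = card (carrier A) - 1"
proof -
  have "{y \<in> carrier A. y \<preceq> \<sim> \<zero> \<and> y \<noteq> \<sim> \<zero>} = carrier A - {\<sim> \<zero>}"
    by (auto simp: mv_le_def plus_top neg_closed)
  then show ?thesis by (simp add: mv_rank_def neg_closed card_Diff_singleton)
qed

text \<open>The pair \<open>x\<close>, \<open>\<sim> x\<close> is the boundary case of
  \<open>rank_plus\<close>: the sum just reaches the top.\<close>

lemma rank_plus_rank_neg: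
  assumes "finite (carrier A)" "x \<in> carrier A"
  shows "mv_rank A x + mv_rank A (\<sim> x) = card (carrier A) - 1"
  using rank_plus[of x "\<sim> x"] assms by (simp add: neg_closed le_refl plus_neg rank_top)

lemma rank_plus_min:
  assumes fin: "finite (carrier A)" and c: "x \<in> carrier A" "y \<in> carrier A"
  shows "mv_rank A (x \<oplus> y) = min (mv_rank A x + mv_rank A y) (card (carrier A) - 1)"
proof (cases "y \<preceq> \<sim> x")
  case True
  have "mv_rank A (x \<oplus> y) < card (carrier A)"
    using bij_betw_apply[OF bij_betw_rank[OF fin]] c by blast
  then show ?thesis using rank_plus[OF fin c True] by simp
next
  case False
  then have le: "\<sim> x \<preceq> y" and ne: "\<sim> x \<noteq> y"
    using c total neg_closed le_refl by blast+
  \<comment> \<open>The sum is truncated to the top, while the ranks add up to more than that of the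
    top because \<open>y\<close> lies strictly above \<open>\<sim> x\<close>.\<close>
  have "x \<oplus> y = \<sim> \<zero>" using le c by (simp add: mv_le_def neg_neg)
  moreover have "mv_rank A (\<sim> x) < mv_rank A y"
    using rank_strict_mono[OF fin _ c(2) le ne] c(1) neg_closed by blast
  ultimately show ?thesis
    using rank_plus_rank_neg[OF fin c(1)] by (simp add: rank_top)
qed

text \<open>Dividing ranks by \<open>?n - 1\<close>, the rank of the top, turns truncation at
  \<open>?n - 1\<close> into truncation at 1.\<close>

lemma finite_isomorphic_L:
  assumes fin: "finite (carrier A)" and nt: "mv_nontrivial A"
  shows "card (carrier A) \<ge> 2" and "A \<cong>\<^sub>M\<^sub>V mv_L (card (carrier A))"
proof -
  let ?n = "card (carrier A)"
  have "card {\<zero>, \<sim> \<zero>} \<le> ?n"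
    using fin by (intro card_mono) (auto simp: neg_closed)
  then show n: "?n \<ge> 2" using nt by (simp add: mv_nontrivial_def)
  then have N: "real (?n - 1) = real ?n - 1" "real ?n - 1 > 0" by auto
  define h where "h x = real (mv_rank A x) / (real ?n - 1)" for x
  have bij: "bij_betw h (carrier A) (carrier (mv_L ?n))"
  proof -
    have "bij_betw (\<lambda>k. real k / (real ?n - 1)) {..<?n} (carrier (mv_L ?n))"
      using N by (auto simp: bij_betw_def inj_on_def mv_L_def)
    from bij_betw_trans[OF bij_betw_rank[OF fin] this] show ?thesis
      by (simp add: comp_def h_def[abs_def])
  qed
  have "h \<in> mv_hom A (mv_L ?n)"
  proof (rule mv_homI)
    fix x assume x: "x \<in> carrier A"
    show "h x \<in> carrier (mv_L ?n)" using bij x by (rule bij_betw_apply)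
    have "real (mv_rank A x) + real (mv_rank A (\<sim> x)) = real ?n - 1"
      using rank_plus_rank_neg[OF fin x] N(1) by (metis of_nat_add)
    then show "h (\<sim> x) = \<sim>\<^bsub>mv_L ?n\<^esub> (h x)"
      using N by (simp add: h_def mv_L_def mv_unit_interval_def field_simps)
  next
    fix x y assume "x \<in> carrier A" "y \<in> carrier A"
    then have "real (mv_rank A (x \<oplus> y)) = min (real (mv_rank A x) + real (mv_rank A y)) (real ?n - 1)"
      using rank_plus_min[OF fin, of x y] N(1) by (simp add: of_nat_min del: of_nat_diff)
    then show "h (x \<oplus> y) = h x \<oplus>\<^bsub>mv_L ?n\<^esub> h y"
      using N by (simp add: h_def mv_L_def mv_unit_interval_def min_divide_distrib_right
          add_divide_distrib)
  next
    show "h \<zero> = \<zero>\<^bsub>mv_L ?n\<^esub>"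
      by (simp add: h_def rank_zero mv_L_def mv_unit_interval_def)
  qed
  with bij show "A \<cong>\<^sub>M\<^sub>V mv_L ?n" by (auto simp: mv_isomorphic_def)
qed

end

section \<open>Finite algebras are profinite\<close>

text \<open>Copies the operations along an injection, which allows \<open>A\<close> to be replaced
  by an algebra over the type prescribed for the components of an inverse system.\<close>

lemma mv_algebra_transport:
  fixes A :: "('a, 'm) mv_scheme" and c :: "'a \<Rightarrow> 'b"
  assumes "mv_algebra A" and c: "inj_on c (carrier A)"
  shows "\<exists>B :: 'b mv. mv_algebra B \<and> carrier B = c ` carrier A \<and> c \<in> mv_hom A B"
proof -
  interpret mv_algebra A by fact
  define d where "d = inv_into (carrier A) c"
  have d: "d (c x) = x" if "x \<in> carrier A" for x
    using that c by (simp add: d_def)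
  define B :: "'b mv" where "B = \<lparr>carrier = c ` carrier A, mult = (\<lambda>x y. c (d x \<oplus>\<^bsub>A\<^esub> d y)),
    one = c \<zero>\<^bsub>A\<^esub>, mv_neg = (\<lambda>x. c (\<sim>\<^bsub>A\<^esub> (d x)))\<rparr>"
  have "mv_algebra B"
    by unfold_locales
      (auto simp: B_def d neg_closed neg_neg neg_zero_plus m_assoc
        intro!: arg_cong[of _ _ c] m_comm lukasiewicz)
  moreover have "c \<in> mv_hom A B"
    by (rule mv_homI) (auto simp: B_def d)
  ultimately show ?thesis by (intro exI[of _ B]) (simp add: B_def)
qed

lemma finite_mv_algebra_profinite:
  fixes A :: "('a, 'm) mv_scheme"
  assumes A: "mv_algebra A" and fin: "finite (carrier A)"
  shows "mv_profinite TYPE('i) TYPE('b::infinite) A"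
proof -
  \<comment> \<open>The infinite type \<open>'b\<close> has room for a copy of the finite
    carrier.\<close>
  obtain S :: "'b set" where "finite S" "card S = card (carrier A)"
    using infinite_arbitrarily_large[OF infinite_UNIV] by blast
  then obtain c :: "'a \<Rightarrow> 'b" where "bij_betw c (carrier A) S"
    using fin finite_same_card_bij by metis
  then have c: "inj_on c (carrier A)" by (rule bij_betw_imp_inj_on)
  obtain B :: "'b mv" where B: "mv_algebra B" "carrier B = c ` carrier A" and cB: "c \<in> mv_hom A B"
    using mv_algebra_transport[OF A c] by blast
  \<comment> \<open>Every type is inhabited, so \<open>undefined\<close> supplies the single index,
    whatever \<open>'i\<close> is.\<close>
  define u :: 'i where "u = undefined"
  let ?F = "\<lambda>_::'i. B" and ?\<phi> = "\<lambda>(_::'i) (_::'i) x::'b. x"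
  let ?L = "mv_inverse_limit {u} {(u, u)} ?F ?\<phi>"
  have "mv_inverse_system {u} {(u, u)} ?F ?\<phi>"
  proof (rule mv_inverse_system.intro)
    show "directed_poset {u} {(u, u)}"
      by (auto simp: directed_poset_def partial_order_on_def preorder_on_def refl_on_def
          trans_def antisym_def)
    show "(\<lambda>x. x) \<in> mv_hom B B" by (rule mv_homI) auto
  qed (use B(1) in \<open>auto split: if_splits\<close>)
  moreover have "A \<cong>\<^sub>M\<^sub>V ?L"
    unfolding mv_isomorphic_def
  proof
    let ?h = "\<lambda>x. \<lambda>i\<in>{u}. c x"
    show "?h \<in> mv_hom A ?L"
      by (rule mv_homI) (use mv_homD[OF cB] in \<open>auto simp: mv_inverse_limit_def intro!: restrict_ext\<close>)
    show "bij_betw ?h (carrier A) (carrier ?L)"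
      unfolding bij_betw_def
    proof
      show "inj_on ?h (carrier A)"
        using c by (auto simp: inj_on_def dest!: fun_cong[of _ _ u])
      show "?h ` carrier A = carrier ?L"
      proof
        show "?h ` carrier A \<subseteq> carrier ?L"
          using B(2) by (auto simp: mv_inverse_limit_def PiE_def extensional_def)
        show "carrier ?L \<subseteq> ?h ` carrier A"
        proof
          fix f assume "f \<in> carrier ?L"
          then have f: "f \<in> extensional {u}" "f u \<in> c ` carrier A"
            by (auto simp: mv_inverse_limit_def B(2) PiE_def)
          then obtain x where "x \<in> carrier A" "f u = c x" by blast
          moreover from this have "f = ?h x"
            by (intro extensionalityI[OF f(1)]) auto
          ultimately show "f \<in> ?h ` carrier A" by blast
        qed
      qed
    qed
  qed
  moreover have "finite (carrier B)" using B(2) fin by simp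
  ultimately show ?thesis
    unfolding mv_profinite_def by blast
qed

theorem corollary2p7:
  fixes A :: "('a, 'm) mv_scheme"
  assumes "mv_chain A" and "mv_nontrivial A"
  shows "mv_profinite TYPE('i) TYPE('b::infinite) A \<longleftrightarrow> (\<exists>n::nat. n \<ge> 2 \<and> A \<cong>\<^sub>M\<^sub>V mv_L n)"
proof
  assume "mv_profinite TYPE('i) TYPE('b) A"
  then have "finite (carrier A)"
    using mv_chain_inverse_limit_finite[OF assms] unfolding mv_profinite_def by blast
  then show "\<exists>n::nat. n \<ge> 2 \<and> A \<cong>\<^sub>M\<^sub>V mv_L n"
    using mv_chain.finite_isomorphic_L[OF assms(1)] assms(2) by blast
next
  assume "\<exists>n::nat. n \<ge> 2 \<and> A \<cong>\<^sub>M\<^sub>V mv_L n"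
  \<comment> \<open>Finiteness passes from \<open>mv_L n\<close> to \<open>A\<close> along the
    bijection \<open>h\<close>.\<close>
  then obtain n h where "bij_betw h (carrier A) (carrier (mv_L n))"
    by (auto simp: mv_isomorphic_def)
  moreover have "finite (carrier (mv_L n))" by (simp add: mv_L_def)
  ultimately have "finite (carrier A)" using bij_betw_finite by blast
  then show "mv_profinite TYPE('i) TYPE('b) A"
    using assms(1) by (intro finite_mv_algebra_profinite) (simp add: mv_chain_def)
qed

end
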